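(* For all $\varepsilon>0$ there exist $\delta=\delta(\varepsilon)>0$ and $n_0=n_0(\delta)\in\mathbb{N}$ such that the following holds: if $t$ is a $3$-colouring template for $K_n$ with $n\ge n_0$ satisfying (i) $\mathrm{Ent}(t)\ge(\log_32-\delta)\binom n2$, and (ii) at most $\delta\binom n3$ triangles of $K_n$ are rainbow in some realisation of $t$, then there is a pair of colours $\{c_1,c_2\}\subseteq[3]$ such that $t(e)=\{c_1,c_2\}$ for all but at most $\varepsilon\binom n2$ edges $e$ of $K_n$. (Equivalently, the family of templates $\{1,2\}^{K_n},\{1,3\}^{K_n},\{2,3\}^{K_n}$, $n\in\mathbb{N}$, is a stability family for the property of $3$-colourings of complete graphs with no rainbow triangle.)
   Context: A $3$-colouring template for $K_n$ is $t:E(K_n)\to2^{[3]}\setminus\{\emptyset\}$; a realisation of $t$ is a colouring $c:E(K_n)\to[3]$ with $c(e)\in t(e)$ for all $e$; $\mathrm{Ent}(t)=\sum_e\log_3|t(e)|$. A triangle is rainbow in a colouring if its three edges receive three distinct colours. $\{c_1,c_2\}^{K_n}$ denotes the template assigning $\{c_1,c_2\}$ to every edge. *)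

theory Defs
  imports Complex_Main "HOL-Library.FuncSet"
begin

text \<open>The complete graph \<open>K\<^sub>n\<close> has vertex set \<open>{1..n}\<close>; its edges and triangles are
  represented by the 2-element and 3-element sets of vertices. Colour assignments are total
  functions on vertex sets, of which only the values at edges are ever inspected.\<close>

definition edges_on :: "nat set \<Rightarrow> nat set set" where
  "edges_on V = {e. e \<subseteq> V \<and> card e = 2}"

definition K_edges :: "nat \<Rightarrow> nat set set" where
  "K_edges n = edges_on {1..n}"

definition K_triangles :: "nat \<Rightarrow> nat set set" where
  "K_triangles n = {T. T \<subseteq> {1..n} \<and> card T = 3}"

definition colours :: "nat set" where
  "colours = {1, 2, 3}"

definition template :: "nat \<Rightarrow> (nat set \<Rightarrow> nat set) \<Rightarrow> bool" where
  "template n t \<longleftrightarrow> t \<in> K_edges n \<rightarrow> Pow colours - {{}}"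

definition realisation :: "nat \<Rightarrow> (nat set \<Rightarrow> nat set) \<Rightarrow> (nat set \<Rightarrow> nat) \<Rightarrow> bool" where
  "realisation n t c \<longleftrightarrow> c \<in> K_edges n \<rightarrow> colours \<and> (\<forall>e \<in> K_edges n. c e \<in> t e)"

definition Ent :: "nat \<Rightarrow> (nat set \<Rightarrow> nat set) \<Rightarrow> real" where
  "Ent n t = (\<Sum>e \<in> K_edges n. log 3 (real (card (t e))))"

definition rainbow :: "(nat set \<Rightarrow> nat) \<Rightarrow> nat set \<Rightarrow> bool" where
  "rainbow c T \<longleftrightarrow> inj_on c (edges_on T)"

end

theory Submission imports Defs begin

text \<open>
  If three lists of colours admit no system of distinct representatives, then by Hall's condition
  either two of them are the same singleton or all three lie in a common pair; so the product of
  their sizes is at most 8, and at most 4 unless the three lists are one and the same pair.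
  Averaging the entropy over triangles therefore shows that all but a \<open>12 \<delta>\<close> proportion of the
  triangles carry the same pair on all three edges. Now average twice: choose a vertex \<open>v\<close> in few
  exceptional triangles, and then \<open>x\<close> such that few exceptional triangles contain both \<open>v\<close> and \<open>x\<close>.
  The pair \<open>P\<close> on \<open>vx\<close> occurs on \<open>vy\<close> for most \<open>y\<close>, and hence on most edges \<open>yz\<close>, because most of the
  triangles \<open>vyz\<close> are not exceptional.
\<close>

definition pair_monochromatic :: "(nat set \<Rightarrow> nat set) \<Rightarrow> nat set \<Rightarrow> bool" where
  "pair_monochromatic t T \<longleftrightarrow> (\<exists>P. card P = 2 \<and> (\<forall>e \<in> edges_on T. t e = P))"

section \<open>Counting edges and triangles of the complete graph\<close>

lemma finite_edges_on: "finite V \<Longrightarrow> finite (edges_on V)"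
  unfolding edges_on_def by (rule finite_subset[of _ "Pow V"]) auto

lemma finite_K_edges [simp]: "finite (K_edges n)"
  unfolding K_edges_def by (simp add: finite_edges_on)

lemma finite_K_triangles [simp]: "finite (K_triangles n)"
  unfolding K_triangles_def by (rule finite_subset[of _ "Pow {1..n}"]) auto

lemma card_K_triangles: "card (K_triangles n) = n choose 3"
  using n_subsets[of "{1..n}" 3] by (simp add: K_triangles_def)

lemma edges_on_triangle:
  assumes "a \<noteq> b" "a \<noteq> c" "b \<noteq> c"
  shows "edges_on {a, b, c} = {{a, b}, {a, c}, {b, c}}"
proof
  show "edges_on {a, b, c} \<subseteq> {{a, b}, {a, c}, {b, c}}"
  proof
    fix e assume "e \<in> edges_on {a, b, c}"
    then obtain x y where "e = {x, y}" "x \<noteq> y" "x \<in> {a, b, c}" "y \<in> {a, b, c}"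
      by (auto simp: edges_on_def card_2_iff)
    then show "e \<in> {{a, b}, {a, c}, {b, c}}" by auto
  qed
  show "{{a, b}, {a, c}, {b, c}} \<subseteq> edges_on {a, b, c}"
    using assms by (auto simp: edges_on_def)
qed

lemma real_choose_two: "real (n choose 2) = real n * (real n - 1) / 2"
proof (induction n)
  case (Suc n)
  have "Suc n choose 2 = n + (n choose 2)"
    by (simp only: numeral_2_eq_2 binomial_Suc_Suc binomial_1)
  then show ?case using Suc by (simp add: field_simps)
qed simp

lemma real_choose_three: "real (n choose 3) = real n * (real n - 1) * (real n - 2) / 6"
proof (induction n)
  case (Suc n)
  have "Suc n choose 3 = (n choose 2) + (n choose 3)"
    by (simp only: numeral_3_eq_3 numeral_2_eq_2 binomial_Suc_Suc)
  then show ?case using Suc by (simp add: real_choose_two field_simps)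
qed simp

lemma card_triangles_containing_edge:
  assumes "e \<in> K_edges n"
  shows "card {T \<in> K_triangles n. e \<subseteq> T} = n - 2"
proof -
  have e: "e \<subseteq> {1..n}" "card e = 2" "finite e"
    using assms by (auto simp: K_edges_def edges_on_def intro: finite_subset)
  have "{T \<in> K_triangles n. e \<subseteq> T} = (\<lambda>y. insert y e) ` ({1..n} - e)" (is "?L = ?R")
  proof
    show "?L \<subseteq> ?R"
    proof
      fix T assume T: "T \<in> ?L"
      then have "finite T" by (auto simp: K_triangles_def intro: finite_subset)
      then have "card (T - e) = 1" using T e by (simp add: card_Diff_subset K_triangles_def)
      then obtain y where "T - e = {y}" by (auto simp: card_1_singleton_iff)
      then have "T = insert y e" "y \<notin> e" "y \<in> T" using T by auto
      then show "T \<in> ?R" using T by (auto simp: K_triangles_def)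
    qed
    show "?R \<subseteq> ?L" using e by (auto simp: K_triangles_def)
  qed
  moreover have "inj_on (\<lambda>y. insert y e) ({1..n} - e)" by (auto simp: inj_on_def)
  ultimately show ?thesis using e by (simp add: card_image card_Diff_subset)
qed

text \<open>Double counting: every edge lies in \<open>n - 2\<close> triangles. This is what turns
  \<open>Ent\<close> into an average over triangles; \<open>n \<ge> 2\<close> makes the truncated
  \<open>n - 2\<close> agree with the real one.\<close>

lemma sum_over_triangles:
  fixes f :: "nat set \<Rightarrow> real"
  assumes "n \<ge> 2"
  shows "(\<Sum>T \<in> K_triangles n. \<Sum>e \<in> edges_on T. f e) = (real n - 2) * (\<Sum>e \<in> K_edges n. f e)"
proof -
  have "edges_on T = {e \<in> K_edges n. e \<subseteq> T}" if "T \<in> K_triangles n" for T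
    using that by (auto simp: edges_on_def K_edges_def K_triangles_def)
  then have "(\<Sum>T \<in> K_triangles n. \<Sum>e \<in> edges_on T. f e)
      = (\<Sum>T \<in> K_triangles n. \<Sum>e | e \<in> K_edges n \<and> e \<subseteq> T. f e)" by simp
  also have "\<dots> = (\<Sum>e \<in> K_edges n. \<Sum>T | T \<in> K_triangles n \<and> e \<subseteq> T. f e)"
    by (rule sum.swap_restrict) simp_all
  also have "\<dots> = (\<Sum>e \<in> K_edges n. (real n - 2) * f e)"
    using assms by (simp add: card_triangles_containing_edge)
  finally show ?thesis by (simp add: sum_distrib_left)
qed

section \<open>Lists of colours without distinct representatives\<close>

lemma card_colour_list:
  assumes "A \<in> Pow colours - {{}}"
  shows "1 \<le> card A" "card A \<le> 3"
proof -
  have "finite A" using assms by (auto simp: colours_def intro: finite_subset)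
  then show "1 \<le> card A" using assms by (simp add: Suc_le_eq card_gt_0_iff)
  show "card A \<le> 3" using assms card_mono[of colours A] by (simp add: colours_def)
qed

text \<open>Hall's condition fails in one of two ways. If a colour is absent from all three lists,
  they lie in a common pair, and as they are not all equal to it one of them has size at most 1: the
  product is at most \<open>1 * 2 * 2\<close>. Otherwise two lists have size at most 1 and the third
  at most 3.\<close>

lemma card_product_le_4:
  assumes A: "A \<in> Pow colours - {{}}" and B: "B \<in> Pow colours - {{}}" and C: "C \<in> Pow colours - {{}}"
    and no_sdr: "\<not> (\<exists>a \<in> A. \<exists>b \<in> B. \<exists>c \<in> C. a \<noteq> b \<and> a \<noteq> c \<and> b \<noteq> c)"
    and not_pair: "\<not> (card A = 2 \<and> A = B \<and> B = C)"
  shows "card A * card B * card C \<le> 4"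
proof -
  have sdr: "i \<notin> A \<or> j \<notin> B \<or> k \<notin> C" if "i \<noteq> j" "i \<noteq> k" "j \<noteq> k" for i j k
    using no_sdr that by blast
  have sdrs: "1 \<notin> A \<or> 2 \<notin> B \<or> 3 \<notin> C" "1 \<notin> A \<or> 3 \<notin> B \<or> 2 \<notin> C" "2 \<notin> A \<or> 1 \<notin> B \<or> 3 \<notin> C"
    "2 \<notin> A \<or> 3 \<notin> B \<or> 1 \<notin> C" "3 \<notin> A \<or> 1 \<notin> B \<or> 2 \<notin> C" "3 \<notin> A \<or> 2 \<notin> B \<or> 1 \<notin> C"
    by (rule sdr; simp)+
  have nonempty: "1 \<in> X \<or> 2 \<in> X \<or> 3 \<in> X" if "X \<in> Pow colours - {{}}" for X
    using that by (auto simp: colours_def)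
  \<comment> \<open>Having at most one colour is spelled out through membership. The dichotomy below
    then becomes purely propositional, in the nine atoms that say which colour lies in which
    list.\<close>
  define sing :: "nat set \<Rightarrow> bool"
    where "sing X \<longleftrightarrow> 1 \<notin> X \<and> 2 \<notin> X \<or> 1 \<notin> X \<and> 3 \<notin> X \<or> 2 \<notin> X \<and> 3 \<notin> X" for X
  have sing: "card X \<le> 1" if X: "X \<in> Pow colours - {{}}" and "sing X" for X
  proof -
    have "X \<subseteq> {1} \<or> X \<subseteq> {2} \<or> X \<subseteq> {3}" using that by (auto simp: colours_def sing_def)
    then show ?thesis by (auto dest: card_mono[rotated])
  qed
  have "(1 \<notin> A \<and> 1 \<notin> B \<and> 1 \<notin> C \<or> 2 \<notin> A \<and> 2 \<notin> B \<and> 2 \<notin> C \<or> 3 \<notin> A \<and> 3 \<notin> B \<and> 3 \<notin> C)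
      \<or> sing A \<and> sing B \<or> sing A \<and> sing C \<or> sing B \<and> sing C"
    using sdrs nonempty[OF A] nonempty[OF B] nonempty[OF C] unfolding sing_def by argo
  then consider i where "i \<in> colours" "i \<notin> A" "i \<notin> B" "i \<notin> C"
    | "card A \<le> 1" "card B \<le> 1" | "card A \<le> 1" "card C \<le> 1" | "card B \<le> 1" "card C \<le> 1"
    using sing A B C by (auto simp: colours_def)
  then show ?thesis
  proof cases
    case (1 i)
    define U where "U = colours - {i}"
    have U: "finite U" "card U = 2" "A \<subseteq> U" "B \<subseteq> U" "C \<subseteq> U"
      using 1 A B C by (auto simp: U_def colours_def)
    then have le: "card A \<le> 2" "card B \<le> 2" "card C \<le> 2" using card_mono by metis+
    \<comment> \<open>Three two-element subsets of the two-element set \<open>U\<close> would all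
      equal \<open>U\<close>, which \<open>not_pair\<close> excludes.\<close>
    have "\<not> (card A = 2 \<and> card B = 2 \<and> card C = 2)"
      using not_pair U card_subset_eq by metis
    then have "card A \<le> 1 \<or> card B \<le> 1 \<or> card C \<le> 1" using le by linarith
    then have "card A * card B * card C \<le> 1 * 2 * 2 \<or> card A * card B * card C \<le> 2 * 1 * 2
        \<or> card A * card B * card C \<le> 2 * 2 * 1"
      using le by (meson mult_le_mono)
    then show ?thesis by simp
  next
    case 2
    then have "card A * card B * card C \<le> 1 * 1 * 3" using card_colour_list[OF C] by (intro mult_le_mono)
    then show ?thesis by simp
  next
    case 3
    then have "card A * card B * card C \<le> 1 * 3 * 1" using card_colour_list[OF B] by (intro mult_le_mono)
    then show ?thesis by simp
  next
    case 4
    then have "card A * card B * card C \<le> 3 * 1 * 1" using card_colour_list[OF A] by (intro mult_le_mono)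
    then show ?thesis by simp
  qed
qed

section \<open>Entropy of a triangle and its average\<close>

lemma log_card_colour_list_le_1:
  assumes "A \<in> Pow colours - {{}}"
  shows "log 3 (real (card A)) \<le> 1"
  using card_colour_list[OF assms] by simp

text \<open>This is \<open>3 \<le> 2 ^ 2\<close>. It bounds from below, by a simple constant, the
  entropy lost on a triangle that is neither pair-monochromatic nor rainbow in a
  realisation.\<close>

lemma log_3_2_ge: "log 3 2 \<ge> (1/2 :: real)"
proof -
  have "1 \<le> log 3 (2 ^ 2 :: real)" by simp
  also have "\<dots> = 2 * log 3 (2::real)" by (subst log_nat_power) simp_all
  finally show ?thesis by simp
qed

text \<open>The three edges are distinct, so their colours can be prescribed independently, with any
  admissible colours elsewhere. Hence lists on a triangle that is never rainbow have no distinct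
  representatives.\<close>

lemma rainbow_realisation_exists:
  assumes t: "template n t" and T: "{a, b, c} \<in> K_triangles n"
    and ne: "a \<noteq> b" "a \<noteq> c" "b \<noteq> c"
    and i: "i \<in> t {a, b}" and j: "j \<in> t {a, c}" and k: "k \<in> t {b, c}"
    and dist: "i \<noteq> j" "i \<noteq> k" "j \<noteq> k"
  shows "\<exists>\<chi>. realisation n t \<chi> \<and> rainbow \<chi> {a, b, c}"
proof -
  have edges: "{a, b} \<noteq> {a, c}" "{a, b} \<noteq> {b, c}" "{a, c} \<noteq> {b, c}"
    using ne by (auto simp: doubleton_eq_iff)
  define \<chi> where "\<chi> = (\<lambda>e. SOME i. i \<in> t e)({a, b} := i, {a, c} := j, {b, c} := k)"
  have \<chi>: "\<chi> {a, b} = i" "\<chi> {a, c} = j" "\<chi> {b, c} = k"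
    using edges by (auto simp: \<chi>_def)
  have mem: "\<chi> e \<in> t e" if "e \<in> K_edges n" for e
  proof -
    have "t e \<noteq> {}" using t that by (auto simp: template_def)
    then have "(SOME i. i \<in> t e) \<in> t e" by (simp add: some_in_eq)
    then show ?thesis using i j k by (simp add: \<chi>_def)
  qed
  moreover have "t e \<subseteq> colours" if "e \<in> K_edges n" for e
    using t that by (auto simp: template_def)
  ultimately have "realisation n t \<chi>" by (auto simp: realisation_def)
  moreover have "rainbow \<chi> {a, b, c}"
    using \<chi> dist edges by (simp add: rainbow_def edges_on_triangle[OF ne])
  ultimately show ?thesis by blast
qed

text \<open>Three cases. If the triangle can be rainbow, the trivial bound 3 is paid for by the last
  term. If it carries one pair, the sum is exactly \<open>3 * log 3 2\<close>. Otherwise the product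
  of the sizes is at most 4, so one \<open>log 3 2\<close> is lost. Written with two indicator
  terms, the bound sums directly to counts of triangles.\<close>

lemma triangle_entropy_le:
  assumes t: "template n t" and T: "T \<in> K_triangles n"
  shows "(\<Sum>e \<in> edges_on T. log 3 (real (card (t e))))
    \<le> 3 * log 3 2 - (if pair_monochromatic t T then 0 else log 3 2)
      + (if \<exists>\<chi>. realisation n t \<chi> \<and> rainbow \<chi> T then 3 else 0)"
proof -
  obtain a b c where abc: "T = {a, b, c}" and ne: "a \<noteq> b" "a \<noteq> c" "b \<noteq> c"
    using T by (auto simp: K_triangles_def card_3_iff)
  let ?A = "t {a, b}" and ?B = "t {a, c}" and ?C = "t {b, c}"
  have "{a, b} \<in> K_edges n" "{a, c} \<in> K_edges n" "{b, c} \<in> K_edges n"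
    using T ne by (auto simp: abc K_triangles_def K_edges_def edges_on_def)
  then have mem: "?A \<in> Pow colours - {{}}" "?B \<in> Pow colours - {{}}" "?C \<in> Pow colours - {{}}"
    using t unfolding template_def by blast+
  have sum: "(\<Sum>e \<in> edges_on T. log 3 (real (card (t e))))
      = log 3 (card ?A) + log 3 (card ?B) + log 3 (card ?C)"
    using ne by (simp add: abc edges_on_triangle doubleton_eq_iff)
  have L: "log 3 2 \<ge> (1/2 :: real)" by (rule log_3_2_ge)
  show ?thesis
  proof (cases "\<exists>\<chi>. realisation n t \<chi> \<and> rainbow \<chi> T")
    case True
    then show ?thesis using mem[THEN log_card_colour_list_le_1] L sum by simp
  next
    case False
    show ?thesis
    proof (cases "pair_monochromatic t T")
      case True
      then have "card ?A = 2 \<and> card ?B = 2 \<and> card ?C = 2"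
        by (auto simp: pair_monochromatic_def abc edges_on_triangle[OF ne])
      then show ?thesis using True False sum by simp
    next
      case not_mono: False
      have "\<not> (\<exists>i \<in> ?A. \<exists>j \<in> ?B. \<exists>k \<in> ?C. i \<noteq> j \<and> i \<noteq> k \<and> j \<noteq> k)"
        using False rainbow_realisation_exists[OF t T[unfolded abc] ne] unfolding abc by blast
      moreover have "\<not> (card ?A = 2 \<and> ?A = ?B \<and> ?B = ?C)"
        using not_mono by (auto simp: pair_monochromatic_def abc edges_on_triangle[OF ne])
      ultimately have "card ?A * card ?B * card ?C \<le> 4"
        by (rule card_product_le_4[OF mem])
      then have le: "real (card ?A) * real (card ?B) * real (card ?C) \<le> 4"
        by (metis of_nat_le_iff of_nat_mult of_nat_numeral)
      have pos: "real (card ?A) > 0" "real (card ?B) > 0" "real (card ?C) > 0"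
        using mem[THEN card_colour_list(1)] by auto
      have "log 3 (card ?A) + log 3 (card ?B) + log 3 (card ?C)
          = log 3 (real (card ?A) * real (card ?B) * real (card ?C))"
        using pos by (simp add: log_mult)
      also have "\<dots> \<le> log 3 (2 ^ 2)" using pos le by (subst log_le_cancel_iff) auto
      also have "\<dots> = 2 * log 3 2" by (subst log_nat_power) simp_all
      finally show ?thesis using not_mono False sum by simp
    qed
  qed
qed

lemma card_non_monochromatic_le:
  assumes t: "template n t" and n: "n \<ge> 2"
    and ent: "Ent n t \<ge> (log 3 2 - \<delta>) * real (n choose 2)"
    and few: "real (card {T \<in> K_triangles n. \<exists>\<chi>. realisation n t \<chi> \<and> rainbow \<chi> T})
        \<le> \<delta> * real (n choose 3)"
  shows "real (card {T \<in> K_triangles n. \<not> pair_monochromatic t T}) \<le> 12 * \<delta> * real (n choose 3)"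
proof -
  let ?N = "real (n choose 3)" and ?L = "log 3 2 :: real"
  let ?M = "real (card {T \<in> K_triangles n. \<not> pair_monochromatic t T})"
  let ?R = "real (card {T \<in> K_triangles n. \<exists>\<chi>. realisation n t \<chi> \<and> rainbow \<chi> T})"
  \<comment> \<open>Uses \<open>(n - 2) * (n choose 2) = 3 * (n choose 3)\<close>.\<close>
  have "3 * (?L - \<delta>) * ?N = (real n - 2) * ((?L - \<delta>) * real (n choose 2))"
    by (simp add: real_choose_two real_choose_three field_simps)
  also have "\<dots> \<le> (real n - 2) * Ent n t" using ent n by (intro mult_left_mono) auto
  also have "\<dots> = (\<Sum>T \<in> K_triangles n. \<Sum>e \<in> edges_on T. log 3 (real (card (t e))))"
    by (simp add: Ent_def sum_over_triangles[OF n])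
  also have "\<dots> \<le> (\<Sum>T \<in> K_triangles n. 3 * ?L - (if pair_monochromatic t T then 0 else ?L)
      + (if \<exists>\<chi>. realisation n t \<chi> \<and> rainbow \<chi> T then 3 else 0))"
    by (intro sum_mono triangle_entropy_le[OF t])
  also have "\<dots> = 3 * ?L * ?N - ?L * ?M + 3 * ?R"
  proof -
    have "(\<Sum>T \<in> K_triangles n. if pair_monochromatic t T then 0 else ?L)
        = (\<Sum>T \<in> K_triangles n. if \<not> pair_monochromatic t T then ?L else 0)"
      by (rule sum.cong) auto
    then show ?thesis
      by (simp add: sum.distrib sum_subtractf card_K_triangles flip: sum.inter_filter)
  qed
  \<comment> \<open>One \<open>3 * \<delta> * ?N\<close> comes from the entropy deficit, the other
    from \<open>3 * ?R\<close>. Dividing by \<open>?L \<ge> 1/2\<close> then doubles 6 to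
    12.\<close>
  finally have "?L * ?M \<le> 6 * \<delta> * ?N" using few by (simp add: algebra_simps)
  moreover have "1/2 * ?M \<le> ?L * ?M" by (intro mult_right_mono log_3_2_ge) simp
  ultimately show ?thesis by simp
qed

section \<open>Double averaging towards a dominant pair\<close>

lemma exists_low_degree_element:
  assumes "finite U" "U \<noteq> {}" "finite F" and k: "\<And>T. T \<in> F \<Longrightarrow> card (T \<inter> U) = k"
  shows "\<exists>v \<in> U. card U * card {T \<in> F. v \<in> T} \<le> k * card F"
proof (rule ccontr)
  assume "\<not> ?thesis"
  then have "\<And>v. v \<in> U \<Longrightarrow> k * card F < card U * card {T \<in> F. v \<in> T}" by auto
  then have "(\<Sum>v \<in> U. k * card F) < (\<Sum>v \<in> U. card U * card {T \<in> F. v \<in> T})"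
    using assms by (intro sum_strict_mono) auto
  also have "\<dots> = card U * (\<Sum>v \<in> U. \<Sum>T | T \<in> F \<and> v \<in> T. 1)"
    by (simp add: sum_distrib_left)
  \<comment> \<open>Incidences between \<open>U\<close> and \<open>F\<close> are counted in both
    orders. Each \<open>T\<close> has exactly \<open>k\<close> of them, so degrees all above the
    average would give a number smaller than itself.\<close>
  also have "(\<Sum>v \<in> U. \<Sum>T | T \<in> F \<and> v \<in> T. 1) = (\<Sum>T \<in> F. \<Sum>v | v \<in> U \<and> v \<in> T. (1::nat))"
    using assms by (intro sum.swap_restrict)
  also have "\<dots> = (\<Sum>T \<in> F. k)"
    using k by (intro sum.cong) (auto simp: Int_def conj_commute)
  finally show False by simp
qed

text \<open>Averaging gives \<open>v\<close> in at most
  \<open>\<eta> * (n - 1) * (n - 2) / 2\<close> exceptional triangles, then \<open>x\<close> for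
  which at most \<open>\<eta> * (n - 2)\<close> vertices \<open>y\<close> make
  \<open>{v, x, y}\<close> exceptional. An edge whose list is not that of \<open>{v, x}\<close>
  either meets this set of vertices or forms an exceptional triangle with \<open>v\<close>.\<close>

lemma exists_dominant_pair:
  assumes n: "n \<ge> 3" and \<eta>: "\<eta> < 1"
    and few: "real (card {T \<in> K_triangles n. \<not> pair_monochromatic t T}) \<le> \<eta> * real (n choose 3)"
  shows "\<exists>e\<^sub>0 \<in> K_edges n. card (t e\<^sub>0) = 2 \<and>
    real (card {e \<in> K_edges n. t e \<noteq> t e\<^sub>0}) \<le> 3 * \<eta> * real (n choose 2)"
proof -
  define F where "F = {T \<in> K_triangles n. \<not> pair_monochromatic t T}"
  have fin: "finite F" by (simp add: F_def)
  have sub: "T \<subseteq> {1..n} \<and> card T = 3" if "T \<in> F" for T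
    using that by (simp add: F_def K_triangles_def)
  have "\<exists>v \<in> {1..n}. card {1..n} * card {T \<in> F. v \<in> T} \<le> 3 * card F"
  proof (rule exists_low_degree_element)
    show "card (T \<inter> {1..n}) = 3" if "T \<in> F" for T
      using sub[OF that] by (simp add: Int_absorb2)
  qed (use n fin in auto)
  then obtain v where v: "v \<in> {1..n}" and v_le: "n * card {T \<in> F. v \<in> T} \<le> 3 * card F" by auto
  define F\<^sub>v where "F\<^sub>v = {T \<in> F. v \<in> T}"
  have finv: "finite F\<^sub>v" using fin by (simp add: F\<^sub>v_def)
  have cardU: "card ({1..n} - {v}) = n - 1" using v by simp
  \<comment> \<open>All triangles of \<open>F\<^sub>v\<close> contain \<open>v\<close>, so each has
    two vertices in the remaining ground set of size \<open>n - 1\<close>.\<close>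
  have "\<exists>x \<in> {1..n} - {v}. card ({1..n} - {v}) * card {T \<in> F\<^sub>v. x \<in> T} \<le> 2 * card F\<^sub>v"
  proof (rule exists_low_degree_element)
    show "{1..n} - {v} \<noteq> {}"
    proof
      assume "{1..n} - {v} = {}"
      then have "n - 1 = 0" using cardU by (metis card.empty)
      then show False using n by simp
    qed
    show "card (T \<inter> ({1..n} - {v})) = 2" if "T \<in> F\<^sub>v" for T
    proof -
      have "T \<inter> ({1..n} - {v}) = T - {v}" using sub[of T] that by (auto simp: F\<^sub>v_def)
      then show ?thesis using sub[of T] that by (simp add: F\<^sub>v_def)
    qed
  qed (use finv in auto)
  then obtain x where x: "x \<in> {1..n}" "x \<noteq> v"
    and x_le: "(n - 1) * card {T \<in> F\<^sub>v. x \<in> T} \<le> 2 * card F\<^sub>v" unfolding cardU by blast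
  define Y where "Y = {y \<in> {1..n} - {v, x}. {v, x, y} \<in> F}"
  define P where "P = t {v, x}"
  have finY: "finite Y" by (simp add: Y_def)
  have "card Y = card ((\<lambda>y. {v, x, y}) ` Y)"
    by (rule card_image[symmetric]) (auto simp: inj_on_def Y_def)
  also have "\<dots> \<le> card {T \<in> F\<^sub>v. x \<in> T}"
    by (intro card_mono finite_subset[OF _ finv]) (auto simp: Y_def F\<^sub>v_def)
  finally have Y_le: "(n - 1) * card Y \<le> 2 * card F\<^sub>v"
    using x_le by (meson le_trans mult_le_mono2)

  have rn: "real n \<ge> 3" using n by simp
  have "real n * real (card F\<^sub>v) \<le> 3 * real (card F)"
    using v_le unfolding F\<^sub>v_def by (metis of_nat_le_iff of_nat_mult of_nat_numeral)
  also have "\<dots> \<le> real n * (\<eta> * ((real n - 1) * (real n - 2) / 2))"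
    using few by (simp add: F_def real_choose_three field_simps)
  finally have Fv: "real (card F\<^sub>v) \<le> \<eta> * ((real n - 1) * (real n - 2) / 2)"
    using rn by (subst (asm) mult_le_cancel_left_pos) auto
  have "(real n - 1) * real (card Y) = real ((n - 1) * card Y)" using n by simp
  also have "\<dots> \<le> real (2 * card F\<^sub>v)" using Y_le by (rule of_nat_mono)
  also have "\<dots> \<le> (real n - 1) * (\<eta> * (real n - 2))" using Fv by (simp add: field_simps)
  finally have Yr: "real (card Y) \<le> \<eta> * (real n - 2)"
    using rn by (subst (asm) mult_le_cancel_left_pos) auto
  \<comment> \<open>The sign of \<eta> is read off from \<open>0 \<le> card Y\<close>; it is needed
    to scale the final polynomial inequality.\<close>
  have \<eta>0: "\<eta> \<ge> 0"
  proof -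
    have "0 \<le> \<eta> * (real n - 2)" using Yr by (meson le_trans of_nat_0_le_iff order_trans)
    then show ?thesis using rn by (simp add: zero_le_mult_iff)
  qed

  have mono: "card P = 2 \<and> t {v, y} = P \<and> t {x, y} = P"
    if "y \<in> {1..n}" "y \<noteq> v" "y \<noteq> x" "y \<notin> Y" for y
  proof -
    have "{v, x, y} \<in> K_triangles n" using that v x by (auto simp: K_triangles_def)
    then have "pair_monochromatic t {v, x, y}" using that by (auto simp: Y_def F_def)
    then show ?thesis using that x
      by (auto simp: pair_monochromatic_def edges_on_triangle P_def)
  qed
  \<comment> \<open>Since \<open>\<eta> < 1\<close>, \<open>Y\<close> does not exhaust the
    \<open>n - 2\<close> possible third vertices. Some triangle on \<open>v\<close> and
    \<open>x\<close> is therefore pair-monochromatic, and its pair is \<open>P\<close>.\<close>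
  have "card P = 2"
  proof -
    note Yr
    also have "\<eta> * (real n - 2) < 1 * (real n - 2)"
      using \<eta> rn by (intro mult_strict_right_mono) auto
    finally have "real (card Y) < real n - 2" by simp
    moreover have "card ({1..n} - {v, x}) = n - 2" using v x by (simp add: card_Diff_subset)
    ultimately have "card Y < card ({1..n} - {v, x})" using n by linarith
    then have "\<not> {1..n} - {v, x} \<subseteq> Y" using card_mono[OF finY] by (meson not_le)
    then show ?thesis using mono by blast
  qed
  moreover have "{v, x} \<in> K_edges n" using v x by (auto simp: K_edges_def edges_on_def)
  moreover have "real (card {e \<in> K_edges n. t e \<noteq> P}) \<le> 3 * \<eta> * real (n choose 2)"
  proof -
    \<comment> \<open>\<open>?A\<close> holds the edges opposite \<open>v\<close> in exceptional
      triangles, \<open>?B\<close> those with an end in \<open>Y\<close>. Indexing \<open>?B\<close>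
      by ordered pairs overcounts harmlessly.\<close>
    have "{e \<in> K_edges n. t e \<noteq> P}
        \<subseteq> (\<lambda>T. T - {v}) ` F\<^sub>v \<union> (\<lambda>(y, z). {y, z}) ` (Y \<times> {1..n})" (is "_ \<subseteq> ?A \<union> ?B")
    proof
      fix e assume e: "e \<in> {e \<in> K_edges n. t e \<noteq> P}"
      then have "e \<subseteq> {1..n}" "card e = 2" by (auto simp: K_edges_def edges_on_def)
      then obtain y z where yz: "e = {y, z}" "y \<noteq> z" "y \<in> {1..n}" "z \<in> {1..n}"
        unfolding card_2_iff by blast
      have ne: "t {y, z} \<noteq> P" "t {z, y} \<noteq> P" using e yz(1) by (simp_all add: insert_commute)
      show "e \<in> ?A \<union> ?B"
      proof (cases "y \<in> Y \<or> z \<in> Y")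
        case True
        then have "(y, z) \<in> Y \<times> {1..n} \<or> (z, y) \<in> Y \<times> {1..n}" using yz by auto
        moreover have "e = (\<lambda>(y, z). {y, z}) (y, z)" "e = (\<lambda>(y, z). {y, z}) (z, y)"
          using yz(1) by auto
        ultimately have "e \<in> ?B" by blast
        then show ?thesis by simp
      next
        case False
        have tvx: "t {v, x} = P" "t {x, v} = P" by (simp_all add: P_def insert_commute)
        \<comment> \<open>An edge through \<open>v\<close> or \<open>x\<close> with no end in
          \<open>Y\<close> has list \<open>P\<close>: it is \<open>{v, x}\<close> itself or is
          covered by \<open>mono\<close>.\<close>
        have "y \<noteq> v" "z \<noteq> v" "y \<noteq> x" "z \<noteq> x"
          using ne yz False mono tvx by blast+
        then have tv: "t {v, y} = P" "t {v, z} = P" using mono yz False by auto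
        have "\<not> pair_monochromatic t {v, y, z}"
        proof
          assume "pair_monochromatic t {v, y, z}"
          then have "t {y, z} = t {v, y}"
            using \<open>y \<noteq> v\<close> \<open>z \<noteq> v\<close> yz(2)
            by (auto simp: pair_monochromatic_def edges_on_triangle)
          then show False using ne(1) tv by simp
        qed
        then have "{v, y, z} \<in> F\<^sub>v"
          using v yz \<open>y \<noteq> v\<close> \<open>z \<noteq> v\<close> by (auto simp: F\<^sub>v_def F_def K_triangles_def)
        moreover have "e = {v, y, z} - {v}" using yz(1) \<open>y \<noteq> v\<close> \<open>z \<noteq> v\<close> by auto
        ultimately show ?thesis by blast
      qed
    qed
    then have "card {e \<in> K_edges n. t e \<noteq> P} \<le> card (?A \<union> ?B)"
      using finv finY by (intro card_mono) auto
    also have "\<dots> \<le> card ?A + card ?B" by (rule card_Un_le)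
    also have "\<dots> \<le> card F\<^sub>v + card (Y \<times> {1..n})"
      using finv finY by (intro add_mono card_image_le) auto
    finally have "real (card {e \<in> K_edges n. t e \<noteq> P}) \<le> real (card F\<^sub>v + card Y * n)"
      by (simp add: card_cartesian_product del: of_nat_add of_nat_mult)
    also have "\<dots> = real (card F\<^sub>v) + real (card Y) * real n" by simp
    also have "\<dots> \<le> \<eta> * ((real n - 1) * (real n - 2) / 2) + \<eta> * (real n - 2) * real n"
      using Fv Yr by (intro add_mono mult_right_mono) auto
    also have "\<dots> = \<eta> * ((real n - 1) * (real n - 2) / 2 + (real n - 2) * real n)"
      by (simp add: algebra_simps)
    \<comment> \<open>The first summand is at most one \<open>n choose 2\<close>, the second at most
      two.\<close>
    also have "\<dots> \<le> \<eta> * (3 * real (n choose 2))"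
      using \<eta>0 rn by (intro mult_left_mono) (simp_all add: real_choose_two field_simps)
    finally show ?thesis by (simp add: algebra_simps)
  qed
  ultimately show ?thesis unfolding P_def by blast
qed

theorem theorem4p16:
  "\<forall>\<epsilon>::real. \<epsilon> > 0 \<longrightarrow> (\<exists>\<delta>::real. \<delta> > 0 \<and> (\<exists>n\<^sub>0::nat. \<forall>n t. n \<ge> n\<^sub>0 \<longrightarrow> template n t \<longrightarrow>
      Ent n t \<ge> (log 3 2 - \<delta>) * real (n choose 2) \<longrightarrow>
      real (card {T \<in> K_triangles n. \<exists>c. realisation n t c \<and> rainbow c T})
        \<le> \<delta> * real (n choose 3) \<longrightarrow>
      (\<exists>c\<^sub>1 \<in> colours. \<exists>c\<^sub>2 \<in> colours. c\<^sub>1 \<noteq> c\<^sub>2 \<and>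
        real (card {e \<in> K_edges n. t e \<noteq> {c\<^sub>1, c\<^sub>2}}) \<le> \<epsilon> * real (n choose 2))))"
proof (intro allI impI)
  fix \<epsilon> :: real assume "\<epsilon> > 0"
  \<comment> \<open>The factor 36 is 12 from the triangle average times 3 from the edge count. The
    cap \<open>1 / 24\<close> keeps \<open>12 * \<delta>\<close> below 1, as finding the dominant
    pair demands. The threshold \<open>n\<^sub>0 = 3\<close> suffices.\<close>
  define \<delta> where "\<delta> = min (\<epsilon> / 36) (1 / 24)"
  have \<delta>: "\<delta> > 0" "12 * \<delta> < 1" "3 * (12 * \<delta>) \<le> \<epsilon>" using \<open>\<epsilon> > 0\<close> by (auto simp: \<delta>_def)
  have "\<exists>c\<^sub>1 \<in> colours. \<exists>c\<^sub>2 \<in> colours. c\<^sub>1 \<noteq> c\<^sub>2 \<and>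
        real (card {e \<in> K_edges n. t e \<noteq> {c\<^sub>1, c\<^sub>2}}) \<le> \<epsilon> * real (n choose 2)"
    if n: "n \<ge> 3" and t: "template n t" and ent: "Ent n t \<ge> (log 3 2 - \<delta>) * real (n choose 2)"
      and few: "real (card {T \<in> K_triangles n. \<exists>c. realisation n t c \<and> rainbow c T})
        \<le> \<delta> * real (n choose 3)" for n t
  proof -
    have "real (card {T \<in> K_triangles n. \<not> pair_monochromatic t T}) \<le> 12 * \<delta> * real (n choose 3)"
      using card_non_monochromatic_le[OF t _ ent few] n by simp
    from exists_dominant_pair[OF n \<delta>(2) this]
    obtain e\<^sub>0 where e\<^sub>0: "e\<^sub>0 \<in> K_edges n" "card (t e\<^sub>0) = 2"
      and le: "real (card {e \<in> K_edges n. t e \<noteq> t e\<^sub>0}) \<le> 3 * (12 * \<delta>) * real (n choose 2)"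
      by blast
    obtain c\<^sub>1 c\<^sub>2 where c: "t e\<^sub>0 = {c\<^sub>1, c\<^sub>2}" "c\<^sub>1 \<noteq> c\<^sub>2" using e\<^sub>0(2) by (auto simp: card_2_iff)
    have "c\<^sub>1 \<in> colours" "c\<^sub>2 \<in> colours" using t e\<^sub>0(1) c(1) by (auto simp: template_def)
    moreover have "3 * (12 * \<delta>) * real (n choose 2) \<le> \<epsilon> * real (n choose 2)"
      using \<delta>(3) by (intro mult_right_mono) auto
    ultimately show ?thesis using order_trans[OF le] c by auto
  qed
  then show "\<exists>\<delta>>0. \<exists>n\<^sub>0. \<forall>n t. n\<^sub>0 \<le> n \<longrightarrow> template n t \<longrightarrow>
      (log 3 2 - \<delta>) * real (n choose 2) \<le> Ent n t \<longrightarrow>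
      real (card {T \<in> K_triangles n. \<exists>c. realisation n t c \<and> rainbow c T})
        \<le> \<delta> * real (n choose 3) \<longrightarrow>
      (\<exists>c\<^sub>1 \<in> colours. \<exists>c\<^sub>2 \<in> colours. c\<^sub>1 \<noteq> c\<^sub>2 \<and>
        real (card {e \<in> K_edges n. t e \<noteq> {c\<^sub>1, c\<^sub>2}}) \<le> \<epsilon> * real (n choose 2))"
    using \<delta>(1) by blast
qed

end
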